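(* Let $\Gamma_M$ ($M>0$) be a family of nonatomic routing games with a single OD pair, sharing the same graph, path set $\mathcal P$ and edge cost functions $(c_e)_{e\in\mathcal E}$, where $M$ is the traffic demand of the OD pair. Suppose there is a function $c:(0,\infty)\to(0,\infty)$, regularly varying at $0$, which is a benchmark for $(c_e)_{e\in\mathcal E}$ at $0$, and that the network is tight relative to $c$ at $0$, i.e. $0<\alpha<\infty$ where $\alpha=\min_{p\in\mathcal P}\max_{e\in p}\alpha_e$ and $\alpha_e=\lim_{x\to 0}c_e(x)/c(x)$. Then $\lim_{M\to 0}\mathrm{PoA}(\Gamma_M)=1$.
   Context: A nonatomic routing game consists of: a finite directed multigraph with edge set $\mathcal E$; a finite set $\mathcal I$ of origin–destination (OD) pairs, each $i\in\mathcal I$ with a demand $m^i\ge 0$ and a nonempty finite set $\mathcal P^i$ of paths (sequences of edges) from its origin to its destination, the sets $\mathcal P^i$ pairwise disjoint, $\mathcal P=\bigcup_i\mathcal P^i$; and for each edge $e$ a continuous nondecreasing cost function $c_e:[0,\infty)\to[0,\infty)$. The total inflow is $M=\sum_i m^i>0$. A feasible flow is $f\in\mathbb R_+^{\mathcal P}$ with $\sum_{p\in\mathcal P^i}f_p=m^i$ for all $i$; it induces loads $x_e=\sum_{p\ni e}f_p$ and path costs $c_p(f)=\sum_{e\in p}c_e(x_e)$. A Wardrop equilibrium is a feasible flow $f^*$ with $c_p(f^* )\le c_{p'}(f^* )$ for all $i$ and all $p,p'\in\mathcal P^i$ with $f^*_p>0$. The social cost of a load profile is $L(x)=\sum_e x_e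 c_e(x_e)$; $\mathrm{Opt}(\Gamma)$ is the minimum of $L$ over loads induced by feasible flows, and $\mathrm{Eq}(\Gamma)=L(x^* )$ for the load $x^*$ of a Wardrop equilibrium (all equilibria have the same social cost). The price of anarchy is $\mathrm{PoA}(\Gamma)=\mathrm{Eq}(\Gamma)/\mathrm{Opt}(\Gamma)$; it is assumed throughout that $\mathrm{Opt}(\Gamma)>0$ (if $\mathrm{Opt}(\Gamma)=0$ one sets $\mathrm{PoA}=1$). For $\omega\in\{0,\infty\}$, a function $g:(0,\infty)\to(0,\infty)$ is regularly varying at $\omega$ if $\lim_{t\to\omega}g(tx)/g(t)$ exists and is finite and nonzero for every $x>0$. A regularly varying function $c$ at $\omega$ is a benchmark for the costs $(c_e)$ at $\omega$ if the (possibly infinite) limit $\alpha_e=\lim_{x\to\omega}c_e(x)/c(x)\in[0,\infty]$ exists for every edge $e$. *)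

theory Defs
  imports "HOL-Analysis.Analysis"
begin

definition is_path :: "'e set \<Rightarrow> ('e \<Rightarrow> 'v) \<Rightarrow> ('e \<Rightarrow> 'v) \<Rightarrow> 'v \<Rightarrow> 'v \<Rightarrow> 'e list \<Rightarrow> bool" where
  "is_path E src tgt orig dest p \<longleftrightarrow>
     p \<noteq> [] \<and> distinct p \<and> set p \<subseteq> E \<and>
     src (hd p) = orig \<and> tgt (last p) = dest \<and>
     (\<forall>i. Suc i < length p \<longrightarrow> tgt (p ! i) = src (p ! Suc i))"

definition feasible :: "'e list set \<Rightarrow> real \<Rightarrow> ('e list \<Rightarrow> real) \<Rightarrow> bool" where
  "feasible P m f \<longleftrightarrow> (\<forall>p\<in>P. f p \<ge> 0) \<and> (\<Sum>p\<in>P. f p) = m"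

definition load :: "'e list set \<Rightarrow> ('e list \<Rightarrow> real) \<Rightarrow> 'e \<Rightarrow> real" where
  "load P f e = (\<Sum>p\<in>{p\<in>P. e \<in> set p}. f p)"

definition path_cost :: "'e list set \<Rightarrow> ('e \<Rightarrow> real \<Rightarrow> real) \<Rightarrow> ('e list \<Rightarrow> real) \<Rightarrow> 'e list \<Rightarrow> real" where
  "path_cost P ce f p = (\<Sum>e\<in>set p. ce e (load P f e))"

definition wardrop_eq :: "'e list set \<Rightarrow> ('e \<Rightarrow> real \<Rightarrow> real) \<Rightarrow> real \<Rightarrow> ('e list \<Rightarrow> real) \<Rightarrow> bool" where
  "wardrop_eq P ce m f \<longleftrightarrow> feasible P m f \<and>
     (\<forall>p\<in>P. \<forall>p'\<in>P. f p > 0 \<longrightarrow> path_cost P ce f p \<le> path_cost P ce f p')"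

definition social_cost :: "'e set \<Rightarrow> 'e list set \<Rightarrow> ('e \<Rightarrow> real \<Rightarrow> real) \<Rightarrow> ('e list \<Rightarrow> real) \<Rightarrow> real" where
  "social_cost E P ce f = (\<Sum>e\<in>E. load P f e * ce e (load P f e))"

definition Opt :: "'e set \<Rightarrow> 'e list set \<Rightarrow> ('e \<Rightarrow> real \<Rightarrow> real) \<Rightarrow> real \<Rightarrow> real" where
  "Opt E P ce m = Inf (social_cost E P ce ` {f. feasible P m f})"

text \<open>Equilibrium social cost: the social cost of (some) Wardrop equilibrium;
  all equilibria have the same social cost.\<close>
definition Eq :: "'e set \<Rightarrow> 'e list set \<Rightarrow> ('e \<Rightarrow> real \<Rightarrow> real) \<Rightarrow> real \<Rightarrow> real" where
  "Eq E P ce m = social_cost E P ce (SOME f. wardrop_eq P ce m f)"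

definition PoA :: "'e set \<Rightarrow> 'e list set \<Rightarrow> ('e \<Rightarrow> real \<Rightarrow> real) \<Rightarrow> real \<Rightarrow> real" where
  "PoA E P ce m = (if Opt E P ce m = 0 then 1 else Eq E P ce m / Opt E P ce m)"

definition regularly_varying_at_0 :: "(real \<Rightarrow> real) \<Rightarrow> bool" where
  "regularly_varying_at_0 g \<longleftrightarrow> (\<forall>x>0. g x > 0) \<and>
     (\<forall>x>0. \<exists>l. l \<noteq> 0 \<and> ((\<lambda>t. g (t * x) / g t) \<longlongrightarrow> l) (at_right 0))"

definition benchmark_at_0 :: "'e set \<Rightarrow> ('e \<Rightarrow> real \<Rightarrow> real) \<Rightarrow> (real \<Rightarrow> real) \<Rightarrow> bool" where
  "benchmark_at_0 E ce c \<longleftrightarrow> regularly_varying_at_0 c \<and>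
     (\<forall>e\<in>E. \<exists>a::ereal. ((\<lambda>x. ereal (ce e x / c x)) \<longlongrightarrow> a) (at_right 0))"

definition alpha_e :: "('e \<Rightarrow> real \<Rightarrow> real) \<Rightarrow> (real \<Rightarrow> real) \<Rightarrow> 'e \<Rightarrow> ereal" where
  "alpha_e ce c e = Lim (at_right 0) (\<lambda>x. ereal (ce e x / c x))"

definition alpha :: "'e list set \<Rightarrow> ('e \<Rightarrow> real \<Rightarrow> real) \<Rightarrow> (real \<Rightarrow> real) \<Rightarrow> ereal" where
  "alpha P ce c = (MIN p\<in>P. MAX e\<in>set p. alpha_e ce c e)"

end

theory Submission
  imports Defs
begin

text \<open>An edge attaining \<open>\<alpha>\<close> forces \<open>c\<close> to be asymptotically monotone, hence
  \<open>c (M y) / c M \<longrightarrow> y\<^sup>b\<close> for some \<open>b \<ge> 0\<close>, and the costs with finite \<open>\<alpha>\<^sub>e\<close> are asymptotically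
  \<open>\<alpha>\<^sub>e y\<^sup>b c M\<close> at load \<open>M y\<close>. For costs exactly homogeneous of degree \<open>b\<close>, Young's inequality turns
  the variational inequality \<open>L x \<le> (\<Sum>e. z\<^sub>e c\<^sub>e(x\<^sub>e))\<close> of an equilibrium \<open>x\<close> into
  \<open>L x \<le> (L z + b L x) / (1 + b)\<close>, that is \<open>L x \<le> L z\<close>. For small \<open>M\<close> this holds up to an error
  \<open>o(M c M)\<close>, whereas tightness bounds \<open>L z\<close> from below by a multiple of \<open>M c M\<close>. The edges with
  \<open>\<alpha>\<^sub>e = \<infinity>\<close> only contribute to the error: a flow \<open>z\<close> cheaper than the equilibrium puts a vanishing
  fraction of the demand on them.\<close>

section \<open>Asymptotically homogeneous functions\<close>

text \<open>In logarithmic coordinates \<open>l\<close> becomes an additive function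
  \<open>g\<close>, so this is Cauchy's functional equation; monotonicity is the regularity that
  rules out nonlinear solutions.\<close>

lemma monotone_multiplicative_powr:
  fixes l :: "real \<Rightarrow> real"
  assumes pos: "\<And>x. 0 < x \<Longrightarrow> 0 < l x"
    and mult: "\<And>x y. 0 < x \<Longrightarrow> 0 < y \<Longrightarrow> l (x * y) = l x * l y"
    and mono: "\<And>x y. 0 < x \<Longrightarrow> x \<le> y \<Longrightarrow> l x \<le> l y"
  shows "\<exists>b\<ge>0. \<forall>x>0. l x = x powr b"
proof -
  define g where "g t = ln (l (exp t))" for t
  have add: "g (s + t) = g s + g t" for s t
    using pos[of "exp s"] pos[of "exp t"] by (simp add: g_def exp_add mult ln_mult)
  have gmono: "g s \<le> g t" if "s \<le> t" for s t
    unfolding g_def using that pos[of "exp s"] pos[of "exp t"] mono[of "exp s" "exp t"] by simp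
  have g0: "g 0 = 0" using add[of 0 0] by simp
  have gnat: "g (real n * t) = real n * g t" for n t
    by (induction n) (simp_all add: g0 add algebra_simps)
  have gneg: "g (- t) = - g t" for t
    using add[of t "- t"] g0 by simp
  have gint: "g (of_int k) = of_int k * g 1" for k
  proof (cases k rule: int_cases2)
    case (nonneg n) then show ?thesis using gnat[of n 1] by simp
  next
    case (nonpos n) then show ?thesis using gnat[of n 1] gneg[of "real n"] by simp
  qed
  have b0: "0 \<le> g 1" using gmono[of 0 1] g0 by simp
  have lin: "g t = t * g 1" for t
  proof (rule ccontr)
    assume "g t \<noteq> t * g 1"
    then obtain n :: nat where n: "g 1 < real n * \<bar>g t - t * g 1\<bar>"
      using reals_Archimedean3[of "\<bar>g t - t * g 1\<bar>"] by auto
    \<comment> \<open>Both \<open>g (n t)\<close> and \<open>n t * g 1\<close> lie between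
      \<open>k * g 1\<close> and \<open>(k + 1) * g 1\<close>, a gap that does not grow with
      \<open>n\<close>.\<close>
    define k where "k = \<lfloor>real n * t\<rfloor>"
    have k: "of_int k \<le> real n * t" "real n * t \<le> of_int (k + 1)"
      unfolding k_def by linarith+
    have "of_int k * g 1 \<le> real n * g t" "real n * g t \<le> of_int (k + 1) * g 1"
      using gmono[OF k(1)] gmono[OF k(2)] unfolding gint gnat by auto
    moreover have "of_int k * g 1 \<le> real n * t * g 1" "real n * t * g 1 \<le> of_int (k + 1) * g 1"
      using k b0 by (auto intro: mult_right_mono)
    ultimately have "\<bar>real n * g t - real n * t * g 1\<bar> \<le> g 1"
      by (simp add: algebra_simps abs_le_iff)
    also have "\<bar>real n * g t - real n * t * g 1\<bar> = real n * \<bar>g t - t * g 1\<bar>"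
      by (simp add: abs_mult mult.assoc flip: right_diff_distrib)
    finally show False using n by simp
  qed
  have "l x = x powr g 1" if "0 < x" for x
  proof -
    have "ln (l x) = ln x * g 1" using lin[of "ln x"] that by (simp add: g_def)
    then have "l x = exp (ln x * g 1)" using pos[OF that] by (metis exp_ln)
    then show ?thesis using that by (simp add: powr_def mult.commute)
  qed
  with b0 show ?thesis by blast
qed

text \<open>A Polya-type argument: near \<open>y\<close>, monotonicity squeezes \<open>h M\<close>
  between its values at two fixed points, where it converges, and continuity makes the limits there
  close. Compactness of the interval leaves finitely many such neighbourhoods.\<close>

lemma eventually_uniform_of_monotone_pointwise:
  fixes h :: "'a \<Rightarrow> real \<Rightarrow> real" and k :: "real \<Rightarrow> real"
  assumes mono: "\<forall>\<^sub>F M in F. \<forall>x y. 0 < x \<longrightarrow> x \<le> y \<longrightarrow> h M x \<le> h M y"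
    and lim: "\<And>y. 0 < y \<Longrightarrow> ((\<lambda>M. h M y) \<longlongrightarrow> k y) F"
    and cont: "continuous_on {0<..} k"
    and "0 < \<eta>" "0 < \<epsilon>"
  shows "\<forall>\<^sub>F M in F. \<forall>y\<in>{\<eta>..B}. \<bar>h M y - k y\<bar> \<le> \<epsilon>"
proof -
  have "\<exists>U. open U \<and> y \<in> U \<and> (\<forall>\<^sub>F M in F. \<forall>y'\<in>U. \<bar>h M y' - k y'\<bar> \<le> \<epsilon>)" if y: "y \<in> {\<eta>..B}" for y
  proof -
    have y0: "0 < y" using y \<open>0 < \<eta>\<close> by simp
    then have "isCont k y"
      using cont by (simp add: continuous_on_eq_continuous_at)
    then obtain d where d: "0 < d" "\<And>x. \<bar>x - y\<bar> < d \<Longrightarrow> \<bar>k x - k y\<bar> < \<epsilon> / 4"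
      using \<open>0 < \<epsilon>\<close> unfolding continuous_at_eps_delta by (metis dist_real_def divide_pos_pos zero_less_numeral)
    \<comment> \<open>The bound by \<open>y\<close> keeps \<open>y - r\<close> positive, in the
      range where convergence is known.\<close>
    define r where "r = min d y / 2"
    have r: "0 < r" "r < d" "r < y" using d y0 by (auto simp: r_def min_def)
    have ev: "\<forall>\<^sub>F M in F. \<bar>h M x - k x\<bar> < \<epsilon> / 4" if "0 < x" for x
      using tendstoD[OF lim[OF that], of "\<epsilon> / 4"] \<open>0 < \<epsilon>\<close> by (simp add: dist_real_def)
    have "\<forall>\<^sub>F M in F. \<forall>y'\<in>{y - r<..<y + r}. \<bar>h M y' - k y'\<bar> \<le> \<epsilon>"
      using mono ev[of "y - r", unfolded diff_gt_0_iff_gt, OF r(3)] ev[OF add_pos_pos[OF y0 r(1)]]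
    proof eventually_elim
      case (elim M)
      show ?case
      proof
        fix y' assume y': "y' \<in> {y - r<..<y + r}"
        then have "h M (y - r) \<le> h M y'" "h M y' \<le> h M (y + r)" using elim(1) r by auto
        moreover have "\<bar>k (y - r) - k y\<bar> < \<epsilon> / 4" "\<bar>k (y + r) - k y\<bar> < \<epsilon> / 4" "\<bar>k y' - k y\<bar> < \<epsilon> / 4"
          using d(2) r y' by auto
        ultimately show "\<bar>h M y' - k y'\<bar> \<le> \<epsilon>" using elim(2,3) by linarith
      qed
    qed
    then show ?thesis using r by (intro exI[of _ "{y - r<..<y + r}"]) auto
  qed
  then have "\<forall>y\<in>{\<eta>..B}. \<exists>U. open U \<and> y \<in> U \<and> (\<forall>\<^sub>F M in F. \<forall>y'\<in>U. \<bar>h M y' - k y'\<bar> \<le> \<epsilon>)" by blast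
  from bchoice[OF this] obtain U where
    U: "\<forall>y\<in>{\<eta>..B}. open (U y) \<and> y \<in> U y \<and> (\<forall>\<^sub>F M in F. \<forall>y'\<in>U y. \<bar>h M y' - k y'\<bar> \<le> \<epsilon>)" ..
  obtain Y where Y: "Y \<subseteq> {\<eta>..B}" "finite Y" "{\<eta>..B} \<subseteq> (\<Union>y\<in>Y. U y)"
    by (rule compactE_image[of "{\<eta>..B}" "{\<eta>..B}" U]) (use U in auto)
  have "\<forall>\<^sub>F M in F. \<forall>y\<in>Y. \<forall>y'\<in>U y. \<bar>h M y' - k y'\<bar> \<le> \<epsilon>"
    using Y U by (intro eventually_ball_finite) auto
  then show ?thesis by eventually_elim (use Y in blast)
qed

text \<open>Weighted AM-GM for the powers of order \<open>1 + b\<close>, with weights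
  \<open>1 / (1 + b)\<close> and \<open>b / (1 + b)\<close>; this form includes
  \<open>b = 0\<close>.\<close>

lemma young_powr:
  fixes x z b :: real
  assumes "0 \<le> x" "0 \<le> z" "0 \<le> b"
  shows "z * x powr b \<le> (z powr (1 + b) + b * x powr (1 + b)) / (1 + b)"
proof (cases "x = 0 \<or> z = 0")
  case True
  then show ?thesis using assms by auto
next
  case False
  then have "x > 0" "z > 0" using assms by auto
  have "1 / (1 + b) + b / (1 + b) = 1" using assms by (simp add: field_simps)
  from Youngs_inequality_0[OF _ _ this, of "z powr (1 + b)" "x powr (1 + b)"] \<open>x > 0\<close> \<open>z > 0\<close> assms
  show ?thesis by (simp add: powr_powr add_divide_distrib)
qed

text \<open>Young's inequality for $z x^b$ survives for costs that are asymptotically homogeneous of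
  degree $b$, up to an error that is uniform in the loads. Near the origin the convergence need
  not be uniform, so $x$ is replaced by $\max(x, \eta)$ there.\<close>

lemma asymptotic_young:
  fixes u c :: "real \<Rightarrow> real"
  assumes mono: "mono_on {0..} u" and u0: "\<And>x. 0 \<le> x \<Longrightarrow> 0 \<le> u x"
    and c0: "\<And>x. 0 < x \<Longrightarrow> 0 < c x" and "0 \<le> a" "0 \<le> b"
    and lim: "\<And>y. 0 < y \<Longrightarrow> ((\<lambda>M. u (M * y) / c M) \<longlongrightarrow> a * y powr b) (at_right 0)"
    and "0 < \<epsilon>"
  shows "\<forall>\<^sub>F M in at_right 0. \<forall>x\<in>{0..M}. \<forall>z\<in>{0..M}.
    z * u x \<le> (z * u z + b * (x * u x)) / (1 + b) + \<epsilon> * (M * c M)"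
proof -
  \<comment> \<open>Error budget: one \<delta> for replacing \<open>h x\<close> by the power law,
    and \<delta> + \<open>a\<close> \<eta> for returning to the true costs, in all at most
    \<epsilon>.\<close>
  define \<delta> where "\<delta> = \<epsilon> / 4"
  define \<eta> where "\<eta> = min 1 (\<epsilon> / (2 * (a + 1)))"
  have "0 < \<delta>" using \<open>0 < \<epsilon>\<close> by (simp add: \<delta>_def)
  have \<eta>: "0 < \<eta>" "\<eta> \<le> 1" using assms by (auto simp: \<eta>_def)
  have "a * \<eta> \<le> (a + 1) * (\<epsilon> / (2 * (a + 1)))"
    using assms \<eta> by (intro mult_mono) (auto simp: \<eta>_def)
  then have a\<eta>: "a * \<eta> \<le> \<epsilon> / 2" 
    using \<open>0 \<le> a\<close> nonzero_mult_divide_mult_cancel_left[of "a + 1" \<epsilon> 2] by (simp add: mult.commute)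
  have pos: "\<forall>\<^sub>F M in at_right 0. (0::real) < M" by (rule eventually_at_right_less)
  have "\<forall>\<^sub>F M in at_right 0. \<forall>y\<in>{\<eta>..1}. \<bar>u (M * y) / c M - a * y powr b\<bar> \<le> \<delta>"
  proof (rule eventually_uniform_of_monotone_pointwise)
    show "\<forall>\<^sub>F M in at_right 0. \<forall>x y. 0 < x \<longrightarrow> x \<le> y \<longrightarrow> u (M * x) / c M \<le> u (M * y) / c M"
      using pos
    proof eventually_elim
      case (elim M)
      then show ?case using c0[OF elim]
        by (auto intro!: divide_right_mono mono_onD[OF mono])
    qed
    show "continuous_on {0<..} (\<lambda>y. a * y powr b)"
      by (intro continuous_intros) auto
  qed (use lim \<eta> \<open>0 < \<delta>\<close> in auto)
  with pos show ?thesis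
  proof eventually_elim
    case (elim M)
    \<comment> \<open>Loads are measured in units of \<open>M\<close> and costs in units of
      \<open>c M\<close>, so products of the two scale by \<open>M * c M\<close>.\<close>
    define h where "h y = u (M * y) / c M" for y
    have cM: "0 < c M" using c0 elim by simp
    have h0: "0 \<le> h y" if "0 \<le> y" for y
      using u0[of "M * y"] that elim cM by (simp add: h_def)
    have hmono: "h x \<le> h y" if "0 \<le> x" "x \<le> y" for x y
      unfolding h_def using that elim cM by (auto intro!: divide_right_mono mono_onD[OF mono])
    have close: "\<bar>h y - a * y powr b\<bar> \<le> \<delta>" if "\<eta> \<le> y" "y \<le> 1" for y
      using elim(2) that by (simp add: h_def)
    have pw: "y powr (1 + b) = y * y powr b" if "0 \<le> y" for y :: real
      using that by (cases "y = 0") (auto simp: powr_add)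
    have small: "a * y powr (1 + b) \<le> a * \<eta>" if "0 \<le> y" "y \<le> \<eta>" for y
    proof -
      have "y powr b \<le> 1" using that \<eta> \<open>0 \<le> b\<close> by (intro powr_le1) auto
      then have "y powr (1 + b) \<le> \<eta> * 1" unfolding pw[OF that(1)] using that \<eta> by (intro mult_mono) auto
      then show ?thesis using \<open>0 \<le> a\<close> by (simp add: mult_left_mono)
    qed
    have large: "a * y powr (1 + b) \<le> y * h y + \<delta>" if "\<eta> \<le> y" "y \<le> 1" for y
    proof -
      have "y * (a * y powr b) \<le> y * (h y + \<delta>)"
        using close[OF that] that \<eta> by (intro mult_left_mono) auto
      also have "\<dots> \<le> y * h y + \<delta>" using that \<eta> \<open>0 < \<delta>\<close> by (simp add: algebra_simps mult_left_le)
      finally show ?thesis using that \<eta> by (simp add: pw algebra_simps)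
    qed
    \<comment> \<open>This reaches down to 0 because for \<open>y\<close> \<le> \<eta> the left side
      alone is at most \<open>a\<close> \<eta>.\<close>
    have low: "a * y powr (1 + b) \<le> y * h y + \<delta> + a * \<eta>" if "0 \<le> y" "y \<le> 1" for y
      using small[of y] large[of y] that h0[of y] \<open>0 < \<delta>\<close> \<open>0 \<le> a\<close> \<eta>
        mult_nonneg_nonneg[of y "h y"] mult_nonneg_nonneg[of a \<eta>]
      by (cases "y \<le> \<eta>") linarith+
    have key: "z * h x \<le> (z * h z + b * (x * h x)) / (1 + b) + \<epsilon>"
      if xz: "0 \<le> x" "x \<le> 1" "0 \<le> z" "z \<le> 1" for x z
    proof -
      define w where "w = max x \<eta>"
      have w: "\<eta> \<le> w" "w \<le> 1" "x \<le> w" "0 \<le> w" using xz \<eta> by (auto simp: w_def)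
      have "h x \<le> a * w powr b + \<delta>" using hmono[of x w] close[of w] w xz by linarith
      then have "z * h x \<le> z * (a * w powr b + \<delta>)" using xz by (intro mult_left_mono) auto
      also have "\<dots> \<le> a * (z * w powr b) + \<delta>"
        using xz \<open>0 < \<delta>\<close> by (simp add: algebra_simps mult_left_le)
      also have "a * (z * w powr b) \<le> a * ((z powr (1 + b) + b * w powr (1 + b)) / (1 + b))"
        using xz w assms by (intro mult_left_mono young_powr) auto
      also have "\<dots> = (a * z powr (1 + b) + b * (a * w powr (1 + b))) / (1 + b)"
        by (simp add: algebra_simps)
      also have "\<dots> \<le> ((z * h z + \<delta> + a * \<eta>) + b * (x * h x + \<delta> + a * \<eta>)) / (1 + b)"
      proof (intro divide_right_mono add_mono mult_left_mono)
        show "a * w powr (1 + b) \<le> x * h x + \<delta> + a * \<eta>"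
        proof (cases "x \<le> \<eta>")
          case True
          then show ?thesis
            using small[of \<eta>] \<eta> \<open>0 < \<delta>\<close> mult_nonneg_nonneg[OF xz(1) h0[OF xz(1)]] by (simp add: w_def max_absorb2)
        qed (use low[of x] xz in \<open>simp add: w_def\<close>)
      qed (use low xz \<open>0 \<le> b\<close> in auto)
      also have "\<dots> = (z * h z + b * (x * h x)) / (1 + b) + (\<delta> + a * \<eta>)"
        using \<open>0 \<le> b\<close> by (simp add: field_simps)
      finally show ?thesis using a\<eta> by (simp add: \<delta>_def)
    qed
    show ?case
    proof (intro ballI)
      fix x z assume xz: "x \<in> {0..M}" "z \<in> {0..M}"
      have eq: "v / M * h (y / M) = v * u y / (M * c M)" for v y using elim by (simp add: h_def)
      have "z / M * h (x / M) \<le> (z / M * h (z / M) + b * (x / M * h (x / M))) / (1 + b) + \<epsilon>"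
        using xz elim by (intro key) auto
      then have "z * u x / (M * c M) \<le> ((z * u z + b * (x * u x)) / (1 + b)) / (M * c M) + \<epsilon>"
        unfolding eq by (simp add: add_divide_distrib mult.commute)
      then have "z * u x \<le> (((z * u z + b * (x * u x)) / (1 + b)) / (M * c M) + \<epsilon>) * (M * c M)"
        using elim cM by (simp add: pos_divide_le_eq)
      moreover have "q / (M * c M) * (M * c M) = q" for q using elim cM by simp
      ultimately show "z * u x \<le> (z * u z + b * (x * u x)) / (1 + b) + \<epsilon> * (M * c M)"
        by (simp only: distrib_right[of _ \<epsilon>])
    qed
  qed
qed

section \<open>Rescaled limits and the index of regular variation\<close>

lemma filterlim_mult_at_right_0:
  fixes y :: real
  assumes "0 < y"
  shows "filterlim (\<lambda>t. t * y) (at_right 0) (at_right 0)"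
  unfolding filterlim_at
proof
  show "((\<lambda>t. t * y) \<longlongrightarrow> 0) (at_right 0)" by (auto intro!: tendsto_eq_intros)
  show "\<forall>\<^sub>F t in at_right 0. t * y \<in> {0<..} \<and> t * y \<noteq> 0"
    using eventually_at_right_less[of 0] by eventually_elim (use assms in auto)
qed

text \<open>The ratio factors as \<open>u (t y) / c (t y)\<close> times
  \<open>c (t y) / c t\<close>.\<close>

lemma tendsto_rescale_benchmark:
  fixes u c :: "real \<Rightarrow> real"
  assumes c0: "\<And>x. 0 < x \<Longrightarrow> 0 < c x" and "0 < y"
    and u: "((\<lambda>x. u x / c x) \<longlongrightarrow> a) (at_right 0)"
    and c: "((\<lambda>t. c (t * y) / c t) \<longlongrightarrow> l) (at_right 0)"
  shows "((\<lambda>t. u (t * y) / c t) \<longlongrightarrow> a * l) (at_right 0)"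
proof (rule Lim_transform_eventually)
  show "((\<lambda>t. u (t * y) / c (t * y) * (c (t * y) / c t)) \<longlongrightarrow> a * l) (at_right 0)"
    by (intro tendsto_mult c filterlim_compose[OF u filterlim_mult_at_right_0[OF \<open>0 < y\<close>]])
  show "\<forall>\<^sub>F t in at_right 0. u (t * y) / c (t * y) * (c (t * y) / c t) = u (t * y) / c t"
    using eventually_at_right_less[of 0]
  proof eventually_elim
    case (elim t)
    then show ?case using c0[of "t * y"] \<open>0 < y\<close> by simp
  qed
qed

lemma at_top_rescale_benchmark:
  fixes u c :: "real \<Rightarrow> real"
  assumes c0: "\<And>x. 0 < x \<Longrightarrow> 0 < c x" and "0 < y" "0 < l"
    and u: "filterlim (\<lambda>x. u x / c x) at_top (at_right 0)"
    and c: "((\<lambda>t. c (t * y) / c t) \<longlongrightarrow> l) (at_right 0)"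
  shows "filterlim (\<lambda>t. u (t * y) / c t) at_top (at_right 0)"
proof (rule filterlim_mono_eventually[OF _ order_refl order_refl])
  show "filterlim (\<lambda>t. c (t * y) / c t * (u (t * y) / c (t * y))) at_top (at_right 0)"
    by (intro filterlim_tendsto_pos_mult_at_top[OF c \<open>0 < l\<close>]
        filterlim_compose[OF u filterlim_mult_at_right_0[OF \<open>0 < y\<close>]])
  show "\<forall>\<^sub>F t in at_right 0. c (t * y) / c t * (u (t * y) / c (t * y)) = u (t * y) / c t"
    using eventually_at_right_less[of 0]
  proof eventually_elim
    case (elim t)
    then show ?case using c0[of "t * y"] \<open>0 < y\<close> by simp
  qed
qed

text \<open>The limit function \<open>l\<close> of \<open>c\<close> is multiplicative, and
  monotonicity is borrowed from \<open>u\<close>: the limit of \<open>u (t x) / c t\<close> is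
  \<open>a * l x\<close>, which is monotone in \<open>x\<close>, and \<open>a > 0\<close> can be
  cancelled.\<close>

lemma regularly_varying_power_limit:
  fixes u c :: "real \<Rightarrow> real"
  assumes rv: "regularly_varying_at_0 c" and mono: "mono_on {0..} u"
    and u: "((\<lambda>x. u x / c x) \<longlongrightarrow> a) (at_right 0)" and "0 < a"
  shows "\<exists>b\<ge>0. \<forall>y>0. ((\<lambda>t. c (t * y) / c t) \<longlongrightarrow> y powr b) (at_right 0)"
proof -
  have c0: "0 < c x" if "0 < x" for x using rv that by (simp add: regularly_varying_at_0_def)
  obtain l where l: "\<And>x. 0 < x \<Longrightarrow> l x \<noteq> 0"
    "\<And>x. 0 < x \<Longrightarrow> ((\<lambda>t. c (t * x) / c t) \<longlongrightarrow> l x) (at_right 0)"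
    using rv unfolding regularly_varying_at_0_def by metis
  have pos: "0 < l x" if "0 < x" for x
  proof -
    have "\<forall>\<^sub>F t in at_right 0. 0 \<le> c (t * x) / c t"
      using eventually_at_right_less[of 0]
    proof eventually_elim
      case (elim t)
      then show ?case using c0[of "t * x"] c0[of t] that by simp
    qed
    from tendsto_lowerbound[OF l(2)[OF that] this] show ?thesis using l(1)[OF that] by auto
  qed
  \<comment> \<open>The ratio for \<open>x * y\<close> telescopes through
    \<open>c (t * x)\<close>.\<close>
  have mult: "l (x * y) = l x * l y" if "0 < x" "0 < y" for x y
  proof -
    have "((\<lambda>t. c (t * x * y) / c (t * x) * (c (t * x) / c t)) \<longlongrightarrow> l y * l x) (at_right 0)"
      using that by (intro tendsto_mult l filterlim_compose[OF l(2) filterlim_mult_at_right_0])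
    moreover have "\<forall>\<^sub>F t in at_right 0. c (t * x * y) / c (t * x) * (c (t * x) / c t) = c (t * (x * y)) / c t"
      using eventually_at_right_less[of 0]
    proof eventually_elim
      case (elim t)
      then show ?case using c0[of "t * x"] that by (simp add: mult.assoc)
    qed
    ultimately have "((\<lambda>t. c (t * (x * y)) / c t) \<longlongrightarrow> l y * l x) (at_right 0)"
      by (rule Lim_transform_eventually)
    then show ?thesis
      using tendsto_unique[OF _ l(2)[of "x * y"]] that by (simp add: mult.commute)
  qed
  have lmono: "l x \<le> l y" if "0 < x" "x \<le> y" for x y
  proof -
    have "a * l x \<le> a * l y"
    proof (rule tendsto_le)
      show "((\<lambda>t. u (t * y) / c t) \<longlongrightarrow> a * l y) (at_right 0)"
        using that by (intro tendsto_rescale_benchmark u l c0) auto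
      show "((\<lambda>t. u (t * x) / c t) \<longlongrightarrow> a * l x) (at_right 0)"
        using that by (intro tendsto_rescale_benchmark u l c0) auto
      show "\<forall>\<^sub>F t in at_right 0. u (t * x) / c t \<le> u (t * y) / c t"
        using eventually_at_right_less[of 0]
      proof eventually_elim
        case (elim t)
        then show ?case using c0[of t] that
          by (auto intro!: divide_right_mono mono_onD[OF mono] mult_left_mono)
      qed
    qed simp
    then show ?thesis using \<open>0 < a\<close> by simp
  qed
  have "\<exists>b\<ge>0. \<forall>x>0. l x = x powr b"
    using pos mult lmono by (rule monotone_multiplicative_powr)
  then show ?thesis using l(2) by metis
qed

section \<open>Flows and equilibria\<close>

lemma load_eq_sum_of_bool:
  assumes "finite P"
  shows "load P f e = (\<Sum>p\<in>P. of_bool (e \<in> set p) * f p)"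
  unfolding load_def using assms by (intro sum.mono_neutral_cong_left) auto

text \<open>Double counting of pairs of a path and an edge on it. The weights are arbitrary because
  the main estimate also uses modified edge costs.\<close>

lemma sum_load_mult:
  assumes "finite P" "finite E" "\<And>p. p \<in> P \<Longrightarrow> set p \<subseteq> E"
  shows "(\<Sum>e\<in>E. load P f e * w e) = (\<Sum>p\<in>P. f p * (\<Sum>e\<in>set p. w e))"
proof -
  have *: "(\<Sum>e\<in>E. of_bool (e \<in> set p) * f p * w e) = f p * (\<Sum>e\<in>set p. w e)" if "p \<in> P" for p
  proof -
    have "(\<Sum>e\<in>E. of_bool (e \<in> set p) * f p * w e) = (\<Sum>e\<in>set p. f p * w e)"
      using assms(2) assms(3)[OF that] by (intro sum.mono_neutral_cong_right) auto
    then show ?thesis by (simp add: sum_distrib_left)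
  qed
  have "(\<Sum>e\<in>E. load P f e * w e) = (\<Sum>p\<in>P. \<Sum>e\<in>E. of_bool (e \<in> set p) * f p * w e)"
    by (simp add: load_eq_sum_of_bool[OF assms(1)] sum_distrib_right sum.swap[of _ P E])
  then show ?thesis using * by simp
qed

lemma load_bounds:
  assumes "finite P" "feasible P M f"
  shows "load P f e \<in> {0..M}"
proof -
  have "load P f e \<le> (\<Sum>p\<in>P. f p)"
    unfolding load_def using assms by (intro sum_mono2) (auto simp: feasible_def)
  then show ?thesis using assms by (auto simp: feasible_def load_def intro!: sum_nonneg)
qed

lemma flow_le_load:
  assumes "finite P" "feasible P M f" "p \<in> P" "e \<in> set p"
  shows "f p \<le> load P f e"
  unfolding load_def using assms by (intro member_le_sum) (auto simp: feasible_def)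

text \<open>Flows are functions on all lists, so they are pinned to 0 off \<open>P\<close>; the set
  is then a Tychonoff box cut by a closed hyperplane.\<close>

lemma compact_feasible:
  assumes "finite P"
  shows "compact {f. feasible P M f \<and> (\<forall>p. p \<notin> P \<longrightarrow> f p = 0)}" (is "compact ?K")
proof -
  define S where "S p = (if p \<in> P then {0..M} else {0})" for p
  have "compactin (product_topology (\<lambda>_. euclidean) UNIV) (PiE UNIV S)"
    unfolding compactin_PiE by (auto simp: S_def)
  then have "compact (PiE UNIV S)" by (simp add: euclidean_product_topology)
  moreover have "closed {f. (\<Sum>p\<in>P. f p) = M}"
    by (intro closed_Collect_eq continuous_intros continuous_on_sum continuous_on_product_coordinates)
  ultimately have "compact (PiE UNIV S \<inter> {f. (\<Sum>p\<in>P. f p) = M})" by (rule compact_Int_closed)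
  moreover have "?K = PiE UNIV S \<inter> {f. (\<Sum>p\<in>P. f p) = M}"
  proof (intro set_eqI iffI)
    fix f assume f: "f \<in> ?K"
    then have "f p \<le> M" if "p \<in> P" for p
      using member_le_sum[of p P f] that assms by (auto simp: feasible_def)
    then show "f \<in> PiE UNIV S \<inter> {f. (\<Sum>p\<in>P. f p) = M}"
      using f by (auto simp: S_def feasible_def PiE_iff)
  next
    fix f assume f: "f \<in> PiE UNIV S \<inter> {f. (\<Sum>p\<in>P. f p) = M}"
    then have "f p \<in> S p" for p by (auto simp: PiE_iff)
    then show "f \<in> ?K"
      using f unfolding feasible_def S_def by simp (metis atLeastAtMost_iff singletonD)
  qed
  ultimately show ?thesis by simp
qed

text \<open>A minimiser of the Beckmann potential $\sum_e \int_0^{x_e} c_e$ is an equilibrium: moving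
  flow from a used path $p$ to $p'$ changes the potential at rate $c_{p'} - c_p$. The costs are
  extended to the left of $0$ in order to differentiate at loads equal to $0$.\<close>

lemma wardrop_eq_exists:
  assumes "finite P" "P \<noteq> {}" "0 \<le> M"
    and cont: "\<And>p e. p \<in> P \<Longrightarrow> e \<in> set p \<Longrightarrow> continuous_on {0..} (ce e)"
  shows "\<exists>f. wardrop_eq P ce M f"
proof -
  define U where "U = (\<Union>p\<in>P. set p)"
  have "finite U" using assms by (simp add: U_def)
  have "\<exists>G. \<forall>x\<in>{-1..M+1}. (G has_vector_derivative ce e (max 0 x)) (at x within {-1..M+1})" if "e \<in> U" for e
  proof -
    have "continuous_on {0..} (ce e)" using that cont unfolding U_def by blast
    then have "continuous_on {-1..M+1} (\<lambda>x. ce e (max 0 x))"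
      by (rule continuous_on_compose2) (intro continuous_intros, simp add: image_subset_iff)
    from antiderivative_continuous[OF this] obtain g where
      "\<And>x. x \<in> {-1..M+1} \<Longrightarrow> (g has_vector_derivative ce e (max 0 x)) (at x within {-1..M+1})" by blast
    then show ?thesis by blast
  qed
  then have "\<forall>e\<in>U. \<exists>G. \<forall>x\<in>{-1..M+1}. (G has_vector_derivative ce e (max 0 x)) (at x within {-1..M+1})" ..
  from bchoice[OF this] obtain G where "\<forall>e\<in>U. \<forall>x\<in>{-1..M+1}.
      (G e has_vector_derivative ce e (max 0 x)) (at x within {-1..M+1})" ..
  then have G': "(G e has_vector_derivative ce e (max 0 x)) (at x within {-1..M+1})"
    if "e \<in> U" "x \<in> {-1..M+1}" for e x using that by blast
  have G: "(G e has_real_derivative ce e x) (at x)" if "e \<in> U" "x \<in> {0..M}" for e x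
    using that G'[of e x] at_within_Icc_at[of "-1" x "M + 1"]
    by (simp add: has_real_derivative_iff_has_vector_derivative max_absorb2)
  define K where "K = {f. feasible P M f \<and> (\<forall>p. p \<notin> P \<longrightarrow> f p = 0)}"
  define \<Phi> where "\<Phi> f = (\<Sum>e\<in>U. G e (load P f e))" for f
  obtain p0 where "p0 \<in> P" using assms by auto
  then have "(\<lambda>p. if p = p0 then M else 0) \<in> K"
    using assms by (auto simp: K_def feasible_def)
  then have "K \<noteq> {}" by auto
  have "continuous_on K (\<lambda>f. G e (load P f e))" if "e \<in> U" for e
  proof (rule continuous_on_compose2[of "{0..M}" "G e"])
    show "continuous_on {0..M} (G e)"
      using DERIV_isCont[OF G[OF that]] by (intro continuous_at_imp_continuous_on) blast
    show "continuous_on K (\<lambda>f. load P f e)" unfolding load_def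
      by (intro continuous_on_sum continuous_on_subset[OF continuous_on_product_coordinates]) auto
    show "(\<lambda>f. load P f e) ` K \<subseteq> {0..M}" using load_bounds[OF assms(1)] by (auto simp: K_def)
  qed
  then have "continuous_on K \<Phi>" unfolding \<Phi>_def by (intro continuous_on_sum)
  moreover have "compact K" unfolding K_def using assms by (intro compact_feasible)
  ultimately obtain f where f: "f \<in> K" and min: "\<And>g. g \<in> K \<Longrightarrow> \<Phi> f \<le> \<Phi> g"
    using continuous_attains_inf[of K \<Phi>] \<open>K \<noteq> {}\<close> by auto
  have feas: "feasible P M f" using f by (simp add: K_def)
  have "path_cost P ce f p \<le> path_cost P ce f p'" if p: "p \<in> P" "p' \<in> P" "0 < f p" for p p'
  proof (rule ccontr)
    assume less: "\<not> path_cost P ce f p \<le> path_cost P ce f p'"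
    then have "p \<noteq> p'" by auto
    \<comment> \<open>\<open>g t\<close> moves \<open>t\<close> units of flow from \<open>p\<close>
      to \<open>p'\<close>, and \<open>s e\<close> is the resulting rate of change of the load on
      \<open>e\<close>; it vanishes on shared edges.\<close>
    define s where "s e = of_bool (e \<in> set p') - (of_bool (e \<in> set p) :: real)" for e
    define g where "g t q = f q + t * (of_bool (q = p') - of_bool (q = p))" for t q
    have load_g: "load P (g t) e = load P f e + t * s e" for t e
    proof -
      have "load P (g t) e = (\<Sum>q\<in>P. of_bool (e \<in> set q) * f q) +
          t * ((\<Sum>q\<in>P. of_bool (e \<in> set q) * of_bool (q = p')) - (\<Sum>q\<in>P. of_bool (e \<in> set q) * of_bool (q = p)))"
        by (simp add: load_eq_sum_of_bool[OF assms(1)] g_def algebra_simps sum.distrib sum_distrib_left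
            sum_subtractf)
      also have "(\<Sum>q\<in>P. of_bool (e \<in> set q) * of_bool (q = p')) = (of_bool (e \<in> set p') :: real)"
        using p assms(1) by (subst sum.remove[of _ p']) (auto intro!: sum.neutral)
      also have "(\<Sum>q\<in>P. of_bool (e \<in> set q) * of_bool (q = p)) = (of_bool (e \<in> set p) :: real)"
        using p assms(1) by (subst sum.remove[of _ p]) (auto intro!: sum.neutral)
      finally show ?thesis by (simp add: load_eq_sum_of_bool[OF assms(1)] s_def)
    qed
    have gK: "g t \<in> K" if t: "0 \<le> t" "t \<le> f p" for t
    proof -
      have "(\<Sum>q\<in>P. of_bool (q = p') :: real) = 1" "(\<Sum>q\<in>P. of_bool (q = p) :: real) = 1"
        using p assms(1) by (auto simp: of_bool_def)
      then have "(\<Sum>q\<in>P. g t q) = M"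
        using feas by (simp add: g_def feasible_def sum.distrib sum_subtractf flip: sum_distrib_left)
      moreover have "0 \<le> g t q" if "q \<in> P" for q
        using that feas t by (auto simp: g_def feasible_def of_bool_def)
      moreover have "g t q = 0" if "q \<notin> P" for q
        using that f p by (auto simp: g_def K_def)
      ultimately show ?thesis by (simp add: K_def feasible_def)
    qed
    have "((\<lambda>t. \<Phi> (g t)) has_real_derivative (\<Sum>e\<in>U. ce e (load P f e) * s e)) (at 0)"
      unfolding \<Phi>_def load_g
    proof (rule DERIV_sum)
      fix e assume "e \<in> U"
      have lin: "((\<lambda>t. load P f e + t * s e) has_real_derivative s e) (at 0)"
        by (auto intro!: derivative_eq_intros)
      show "((\<lambda>t. G e (load P f e + t * s e)) has_real_derivative ce e (load P f e) * s e) (at 0)"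
        by (rule DERIV_chain2[OF _ lin]) (use G[OF \<open>e \<in> U\<close> load_bounds[OF assms(1) feas]] in simp)
    qed
    moreover have "(\<Sum>e\<in>U. ce e (load P f e) * s e) = path_cost P ce f p' - path_cost P ce f p"
    proof -
      have "(\<Sum>e\<in>U. ce e (load P f e) * of_bool (e \<in> set q)) = path_cost P ce f q" if "q \<in> P" for q
        unfolding path_cost_def using that \<open>finite U\<close>
        by (intro sum.mono_neutral_cong_right) (auto simp: U_def)
      then show ?thesis using p by (simp add: s_def algebra_simps sum_subtractf)
    qed
    ultimately have "((\<lambda>t. \<Phi> (g t)) has_real_derivative path_cost P ce f p' - path_cost P ce f p) (at 0)"
      by simp
    from DERIV_neg_dec_right[OF this] less obtain d where
      d: "0 < d" "\<And>t. 0 < t \<Longrightarrow> t < d \<Longrightarrow> \<Phi> (g t) < \<Phi> (g 0)" by auto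
    \<comment> \<open>At most \<open>f p\<close> units can leave \<open>p\<close> without violating
      feasibility.\<close>
    define t where "t = min (f p) (d / 2)"
    have "\<Phi> (g t) < \<Phi> (g 0)" using d p by (auto simp: t_def)
    moreover have "g 0 = f" by (auto simp: g_def)
    ultimately show False using min[OF gK[of t]] p d by (auto simp: t_def)
  qed
  then show ?thesis using feas unfolding wardrop_eq_def by blast
qed

lemma wardrop_eq_cost:
  assumes "finite P" "wardrop_eq P ce M f" "0 < M"
  obtains C where "\<And>p. p \<in> P \<Longrightarrow> C \<le> path_cost P ce f p"
    "(\<Sum>p\<in>P. f p * path_cost P ce f p) = M * C"
proof -
  have f: "feasible P M f" using assms by (simp add: wardrop_eq_def)
  have "\<exists>p\<in>P. 0 < f p"
  proof (rule ccontr)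
    assume "\<not> (\<exists>p\<in>P. 0 < f p)"
    then have "(\<Sum>p\<in>P. f p) \<le> 0" by (intro sum_nonpos) (auto simp: not_less)
    then show False using f assms by (simp add: feasible_def)
  qed
  then obtain p where p: "p \<in> P" "0 < f p" by auto
  have le: "path_cost P ce f p \<le> path_cost P ce f q" if "q \<in> P" for q
    using assms(2) p that unfolding wardrop_eq_def by blast
  have "f q * path_cost P ce f q = f q * path_cost P ce f p" if "q \<in> P" for q
  proof (cases "f q = 0")
    case False
    then have "0 < f q" using f that by (auto simp: feasible_def less_le)
    then have "path_cost P ce f q \<le> path_cost P ce f p"
      using assms(2) p that unfolding wardrop_eq_def by blast
    then show ?thesis using le[OF that] by simp
  qed simp
  then have "(\<Sum>q\<in>P. f q * path_cost P ce f q) = (\<Sum>q\<in>P. f q * path_cost P ce f p)"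
    by (rule sum.cong[OF refl])
  then have "(\<Sum>q\<in>P. f q * path_cost P ce f q) = M * path_cost P ce f p"
    using f by (simp add: feasible_def flip: sum_distrib_right)
  with le show thesis by (rule that)
qed

section \<open>Tight networks in light traffic\<close>

text \<open>The set \<open>A\<close> consists of the edges with finite \<open>\<alpha>\<^sub>e = a e\<close>, and \<open>b\<close> is the index of
  regular variation of \<open>c\<close>.\<close>

locale tight_network =
  fixes E A :: "'e set" and P :: "'e list set" and ce :: "'e \<Rightarrow> real \<Rightarrow> real"
    and c :: "real \<Rightarrow> real" and a :: "'e \<Rightarrow> real" and b :: real and p0 :: "'e list"
  assumes finE: "finite E" and finP: "finite P"
    and paths: "p \<in> P \<Longrightarrow> set p \<subseteq> E"
    and ce_mono: "e \<in> E \<Longrightarrow> mono_on {0..} (ce e)"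
    and ce_nonneg: "e \<in> E \<Longrightarrow> 0 \<le> x \<Longrightarrow> 0 \<le> ce e x"
    and c_pos: "0 < x \<Longrightarrow> 0 < c x"
    and A_sub: "A \<subseteq> E"
    and a_nonneg: "e \<in> A \<Longrightarrow> 0 \<le> a e"
    and b_nonneg: "0 \<le> b"
    and light: "e \<in> A \<Longrightarrow> 0 < y \<Longrightarrow> ((\<lambda>M. ce e (M * y) / c M) \<longlongrightarrow> a e * y powr b) (at_right 0)"
    and heavy: "e \<in> E - A \<Longrightarrow> 0 < y \<Longrightarrow> filterlim (\<lambda>M. ce e (M * y) / c M) at_top (at_right 0)"
    and p0: "p0 \<in> P" "set p0 \<subseteq> A"
    and tight: "p \<in> P \<Longrightarrow> \<exists>e\<in>set p. e \<in> A \<longrightarrow> 0 < a e"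
begin

lemma social_cost_eq_sum_paths:
  "social_cost E P ce f = (\<Sum>p\<in>P. f p * path_cost P ce f p)"
  unfolding social_cost_def path_cost_def by (rule sum_load_mult[OF finP finE paths])

lemma edge_cost_nonneg:
  assumes "feasible P M f" "e \<in> E"
  shows "0 \<le> load P f e * ce e (load P f e)"
  using load_bounds[OF finP assms(1), of e] ce_nonneg[OF assms(2)] by simp

lemma edge_cost_le_social_cost:
  assumes "feasible P M f" "e \<in> E"
  shows "load P f e * ce e (load P f e) \<le> social_cost E P ce f"
  unfolding social_cost_def using assms finE edge_cost_nonneg by (intro member_le_sum) auto

text \<open>By pigeonhole some path carries at least \<open>M / n\<close>. Tightness gives an edge
  on it whose cost at that load is at least of order \<open>c M\<close>.\<close>

lemma social_cost_lower_bound: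
  obtains \<delta> where "0 < \<delta>"
    "\<forall>\<^sub>F M in at_right 0. \<forall>g. feasible P M g \<longrightarrow> \<delta> * (M * c M) \<le> social_cost E P ce g"
proof -
  define n where "n = real (card P)"
  have n: "0 < n" using finP p0 by (auto simp: n_def card_gt_0_iff)
  have "\<exists>e \<delta>. e \<in> set p \<and> 0 < \<delta> \<and> (\<forall>\<^sub>F M in at_right 0. \<delta> \<le> ce e (M * (1 / n)) / c M)" if p: "p \<in> P" for p
  proof -
    obtain e where e: "e \<in> set p" "e \<in> A \<longrightarrow> 0 < a e" using tight[OF p] by auto
    show ?thesis
    proof (cases "e \<in> A")
      case True
      define r where "r = a e * (1 / n) powr b"
      have "0 < r" using True e n by (simp add: r_def)
      then have "\<forall>\<^sub>F M in at_right 0. r / 2 < ce e (M * (1 / n)) / c M"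
        using n by (intro order_tendstoD(1)[OF light[OF True]]) (auto simp: r_def[symmetric])
      then show ?thesis using \<open>0 < r\<close> e
        by (intro exI[of _ e] exI[of _ "r / 2"]) (auto elim: eventually_mono)
    next
      case False
      then have "e \<in> E - A" using e p paths by auto
      from heavy[OF this, of "1 / n"] n
      have "\<forall>\<^sub>F M in at_right 0. 1 \<le> ce e (M * (1 / n)) / c M"
        by (auto simp: filterlim_at_top)
      then show ?thesis using e by (intro exI[of _ e] exI[of _ 1]) auto
    qed
  qed
  then obtain e \<delta> where e: "\<And>p. p \<in> P \<Longrightarrow> e p \<in> set p" and \<delta>: "\<And>p. p \<in> P \<Longrightarrow> 0 < \<delta> p"
    and ev: "\<And>p. p \<in> P \<Longrightarrow> \<forall>\<^sub>F M in at_right 0. \<delta> p \<le> ce (e p) (M * (1 / n)) / c M"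
    by metis
  define d where "d = Min (\<delta> ` P)"
  have "P \<noteq> {}" using p0 by auto
  then have d: "0 < d" "\<And>p. p \<in> P \<Longrightarrow> d \<le> \<delta> p"
    using finP \<delta> by (auto simp: d_def)
  show thesis
  proof
    show "0 < d / n" using d n by simp
    have "\<forall>\<^sub>F M in at_right 0. \<forall>p\<in>P. \<delta> p \<le> ce (e p) (M * (1 / n)) / c M"
      using finP ev by (intro eventually_ball_finite) auto
    then show "\<forall>\<^sub>F M in at_right 0. \<forall>g. feasible P M g \<longrightarrow> d / n * (M * c M) \<le> social_cost E P ce g"
      using eventually_at_right_less[of 0]
    proof eventually_elim
      case (elim M)
      show ?case
      proof (intro allI impI)
        fix g assume g: "feasible P M g"
        have "\<exists>p\<in>P. M / n \<le> g p"
        proof (rule ccontr)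
          assume "\<not> (\<exists>p\<in>P. M / n \<le> g p)"
          then have "(\<Sum>p\<in>P. g p) < (\<Sum>p\<in>P. M / n)"
            using finP p0 by (intro sum_strict_mono) auto
          then show False using g n by (simp add: feasible_def n_def)
        qed
        then obtain p where p: "p \<in> P" "M / n \<le> g p" by auto
        have eE: "e p \<in> E" using e[OF p(1)] paths[OF p(1)] by auto
        let ?z = "load P g (e p)"
        have z: "M / n \<le> ?z" using flow_le_load[OF finP g p(1) e[OF p(1)]] p(2) by simp
        have "d \<le> ce (e p) (M / n) / c M" using elim(1) d(2) p(1) by force
        then have "d * c M \<le> ce (e p) (M / n)" using c_pos[OF elim(2)] by (simp add: pos_le_divide_eq)
        also have "\<dots> \<le> ce (e p) ?z"
          using z elim n load_bounds[OF finP g, of "e p"] by (intro mono_onD[OF ce_mono[OF eE]]) auto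
        finally have "M / n * (d * c M) \<le> ?z * ce (e p) ?z"
          using z elim n d c_pos[OF elim(2)] load_bounds[OF finP g] by (intro mult_mono) auto
        also have "\<dots> \<le> social_cost E P ce g" by (rule edge_cost_le_social_cost[OF g eE])
        finally show "d / n * (M * c M) \<le> social_cost E P ce g" by (simp add: mult_ac)
      qed
    qed
  qed
qed

text \<open>No load exceeds \<open>M\<close>, and at load \<open>M\<close> every edge of
  \<open>p0\<close> costs a bounded multiple of \<open>c M\<close>. This bounds the equilibrium path
  cost.\<close>

lemma path_cost_upper_bound:
  obtains K where "0 < K"
    "\<forall>\<^sub>F M in at_right 0. \<forall>f. feasible P M f \<longrightarrow> path_cost P ce f p0 \<le> K * c M"
proof
  define K where "K = 1 + (\<Sum>e\<in>set p0. a e + 1)"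
  have "0 \<le> (\<Sum>e\<in>set p0. a e + 1)" using a_nonneg p0 by (intro sum_nonneg) (auto simp: subset_iff)
  then show "0 < K" by (simp add: K_def)
  have "\<forall>\<^sub>F M in at_right 0. ce e (M * 1) / c M < a e + 1" if "e \<in> set p0" for e
    using that p0 order_tendstoD(2)[OF light[of e 1], of "a e + 1"] by auto
  then have "\<forall>\<^sub>F M in at_right 0. \<forall>e\<in>set p0. ce e (M * 1) / c M < a e + 1"
    by (intro eventually_ball_finite) auto
  then show "\<forall>\<^sub>F M in at_right 0. \<forall>f. feasible P M f \<longrightarrow> path_cost P ce f p0 \<le> K * c M"
    using eventually_at_right_less[of 0]
  proof eventually_elim
    case (elim M)
    show ?case
    proof (intro allI impI)
      fix f assume f: "feasible P M f"
      have "path_cost P ce f p0 \<le> (\<Sum>e\<in>set p0. (a e + 1) * c M)"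
        unfolding path_cost_def
      proof (rule sum_mono)
        fix e assume e: "e \<in> set p0"
        then have eE: "e \<in> E" using p0 A_sub by auto
        have "ce e (load P f e) \<le> ce e M"
          using load_bounds[OF finP f, of e] by (intro mono_onD[OF ce_mono[OF eE]]) auto
        also have "\<dots> \<le> (a e + 1) * c M"
          using elim e c_pos[OF elim(2)] by (fastforce simp: pos_divide_less_eq intro: less_imp_le)
        finally show "ce e (load P f e) \<le> (a e + 1) * c M" .
      qed
      also have "\<dots> \<le> K * c M"
        using c_pos[OF elim(2)] by (simp add: K_def distrib_right[of 1] flip: sum_distrib_right)
      finally show "path_cost P ce f p0 \<le> K * c M" .
    qed
  qed
qed

text \<open>Beyond load \<open>\<eta> * M\<close> the edge cost exceeds
  \<open>K / \<eta> * c M\<close>, so load times cost would exceed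
  \<open>K * (M * c M)\<close>.\<close>

lemma heavy_load_small:
  assumes "e \<in> E - A" "0 < \<eta>"
  shows "\<forall>\<^sub>F M in at_right 0. \<forall>z\<ge>0. z * ce e z \<le> K * (M * c M) \<longrightarrow> z \<le> \<eta> * M"
proof -
  have "\<forall>\<^sub>F M in at_right 0. K / \<eta> < ce e (M * \<eta>) / c M"
    using heavy[OF assms] by (auto simp: filterlim_at_top_dense)
  then show ?thesis using eventually_at_right_less[of 0]
  proof eventually_elim
    case (elim M)
    show ?case
    proof (intro allI impI, rule ccontr)
      fix z assume z: "0 \<le> z" "z * ce e z \<le> K * (M * c M)" "\<not> z \<le> \<eta> * M"
      have "K / \<eta> * c M < ce e (M * \<eta>)" using elim c_pos[OF elim(2)] by (simp add: pos_less_divide_eq)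
      then have "M * \<eta> * (K / \<eta> * c M) < M * \<eta> * ce e (M * \<eta>)"
        using elim assms by (intro mult_strict_left_mono) auto
      also have "\<dots> \<le> z * ce e z"
        using z elim assms ce_nonneg[of e "M * \<eta>"]
        by (intro mult_mono mono_onD[OF ce_mono[of e]]) (auto simp: mult.commute)
      finally show False using z assms by (simp add: mult_ac)
    qed
  qed
qed

text \<open>The threshold on \<open>M\<close> depends only on \<epsilon>, not on the flows, so that
  the infimum over \<open>g\<close> can be taken afterwards.\<close>

lemma wardrop_cost_le_all_flows:
  assumes "0 < \<epsilon>"
  shows "\<forall>\<^sub>F M in at_right 0. \<forall>f g. wardrop_eq P ce M f \<longrightarrow> feasible P M g \<longrightarrow>
    social_cost E P ce f \<le> (1 + \<epsilon>) * social_cost E P ce g"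
proof -
  obtain \<delta> where \<delta>: "0 < \<delta>"
    "\<forall>\<^sub>F M in at_right 0. \<forall>g. feasible P M g \<longrightarrow> \<delta> * (M * c M) \<le> social_cost E P ce g"
    by (rule social_cost_lower_bound)
  obtain K where K: "0 < K"
    "\<forall>\<^sub>F M in at_right 0. \<forall>f. feasible P M f \<longrightarrow> path_cost P ce f p0 \<le> K * c M"
    by (rule path_cost_upper_bound)
  define N where "N = real (card E)"
  \<comment> \<open>Each of the \<open>N\<close> edges will contribute an error
    \<open>\<kappa> * (M * c M)\<close>; multiplied by \<open>1 + b\<close>, the total stays below
    \<epsilon> times the lower bound on the cost of \<open>g\<close>.\<close>
  define \<kappa> where "\<kappa> = \<epsilon> * \<delta> / ((1 + b) * (N + 1))"
  have N: "0 \<le> N" by (simp add: N_def)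
  have \<kappa>: "0 < \<kappa>" using assms \<delta> N b_nonneg by (simp add: \<kappa>_def)
  have "(1 + b) * (N * \<kappa>) \<le> (1 + b) * ((N + 1) * \<kappa>)"
    using \<kappa> b_nonneg by (intro mult_left_mono mult_right_mono) auto
  also have "\<dots> = \<epsilon> * \<delta>" using N b_nonneg by (simp add: \<kappa>_def flip: mult.assoc)
  finally have N\<kappa>: "(1 + b) * (N * \<kappa>) \<le> \<epsilon> * \<delta>" .
  have "\<forall>\<^sub>F M in at_right 0. \<forall>x\<in>{0..M}. \<forall>z\<in>{0..M}.
      z * ce e x \<le> (z * ce e z + b * (x * ce e x)) / (1 + b) + \<kappa> * (M * c M)" if "e \<in> A" for e
    using that A_sub \<kappa>
    by (intro asymptotic_young[where a = "a e"] ce_mono ce_nonneg c_pos a_nonneg b_nonneg light) auto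
  then have "\<forall>\<^sub>F M in at_right 0. \<forall>e\<in>A. \<forall>x\<in>{0..M}. \<forall>z\<in>{0..M}.
      z * ce e x \<le> (z * ce e z + b * (x * ce e x)) / (1 + b) + \<kappa> * (M * c M)"
    using finite_subset[OF A_sub finE] by (intro eventually_ball_finite) auto
  \<comment> \<open>A load of \<open>\<kappa> / K * M\<close> charged at price
    \<open>K * c M\<close> costs \<open>\<kappa> * (M * c M)\<close>, the same error as on an edge
    of \<open>A\<close>.\<close>
  moreover have "\<forall>\<^sub>F M in at_right 0. \<forall>e\<in>E - A. \<forall>z\<ge>0. z * ce e z \<le> K * (M * c M) \<longrightarrow> z \<le> \<kappa> / K * M"
    using finE \<kappa> K by (intro eventually_ball_finite ballI heavy_load_small) auto
  ultimately show ?thesis using \<delta>(2) K(2) eventually_at_right_less[of 0]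
  proof eventually_elim
    case (elim M)
    note young = elim(1) and hv = elim(2) and lower = elim(3) and upper = elim(4) and M = elim(5)
    show ?case
    proof (intro allI impI)
      fix f g assume f: "wardrop_eq P ce M f" and g: "feasible P M g"
      let ?L = "social_cost E P ce"
      have ff: "feasible P M f" using f by (simp add: wardrop_eq_def)
      have Mc: "0 < M * c M" using M c_pos by simp
      obtain C where C: "\<And>p. p \<in> P \<Longrightarrow> C \<le> path_cost P ce f p" "?L f = M * C"
        using wardrop_eq_cost[OF finP f M] unfolding social_cost_eq_sum_paths by metis
      have "0 < M * C" using lower ff \<delta>(1) Mc C(2) by (metis less_le_trans mult_pos_pos)
      then have C0: "0 < C" using M by (simp add: zero_less_mult_iff)
      have CK: "C \<le> K * c M" using C(1)[OF p0(1)] upper ff by force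
      have Lg: "0 < ?L g" using lower g \<delta>(1) Mc by (metis less_le_trans mult_pos_pos)
      show "?L f \<le> (1 + \<epsilon>) * ?L g"
      proof (cases "?L g \<le> K * (M * c M)")
        \<comment> \<open>The equilibrium costs at most \<open>K * (M * c M)\<close>, so it beats
          such an expensive \<open>g\<close> outright.\<close>
        case False
        have "?L f \<le> M * (K * c M)" using C(2) CK M by simp
        also have "\<dots> \<le> ?L g" using False by (simp add: mult_ac)
        also have "\<dots> \<le> (1 + \<epsilon>) * ?L g" using assms Lg by simp
        finally show ?thesis .
      next
        case True
        define x where "x = load P f"
        define z where "z = load P g"
        have x: "x e \<in> {0..M}" and z: "z e \<in> {0..M}" for e
          unfolding x_def z_def using load_bounds[OF finP] ff g by auto
        \<comment> \<open>Charging \<open>C\<close> to every edge outside \<open>A\<close> bounds \<open>C\<close> by the sum of \<open>w\<close> along any path.\<close>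
        define w where "w e = (if e \<in> A then ce e (x e) else C)" for e
        have w0: "0 \<le> w e" if "e \<in> E" for e
          using that C0 x[of e] ce_nonneg by (auto simp: w_def)
        have Cw: "C \<le> (\<Sum>e\<in>set p. w e)" if p: "p \<in> P" for p
        proof (cases "set p \<subseteq> A")
          case True
          then have "(\<Sum>e\<in>set p. w e) = path_cost P ce f p"
            unfolding path_cost_def by (intro sum.cong) (auto simp: w_def x_def)
          then show ?thesis using C(1)[OF p] by simp
        next
          case False
          then obtain e where e: "e \<in> set p" "e \<notin> A" by auto
          then have "w e \<le> (\<Sum>e\<in>set p. w e)"
            using paths[OF p] w0 by (intro member_le_sum) auto
          then show ?thesis using e by (simp add: w_def)
        qed
        \<comment> \<open>The variational inequality with \<open>w\<close> for the equilibrium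
          costs: outside \<open>A\<close> the true cost at \<open>x e\<close> need not be of order
          \<open>c M\<close>, but \<open>C\<close> is.\<close>
        have "?L f = (\<Sum>p\<in>P. g p * C)"
          using C(2) g by (simp add: feasible_def flip: sum_distrib_right)
        also have "\<dots> \<le> (\<Sum>p\<in>P. g p * (\<Sum>e\<in>set p. w e))"
          using Cw g by (intro sum_mono mult_left_mono) (auto simp: feasible_def)
        also have "\<dots> = (\<Sum>e\<in>E. z e * w e)"
          unfolding z_def by (rule sum_load_mult[symmetric, OF finP finE paths])
        also have "\<dots> \<le> (\<Sum>e\<in>E. (z e * ce e (z e) + b * (x e * ce e (x e))) / (1 + b) + \<kappa> * (M * c M))"
        proof (rule sum_mono)
          fix e assume e: "e \<in> E"
          show "z e * w e \<le> (z e * ce e (z e) + b * (x e * ce e (x e))) / (1 + b) + \<kappa> * (M * c M)"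
          proof (cases "e \<in> A")
            case True
            then show ?thesis using young x z by (simp add: w_def)
          next
            case False
            have "z e * ce e (z e) \<le> K * (M * c M)"
              using edge_cost_le_social_cost[OF g e] True by (simp add: z_def)
            then have "z e \<le> \<kappa> / K * M" using hv False e z[of e] by auto
            then have "z e * C \<le> \<kappa> / K * M * (K * c M)"
              using CK C0 z[of e] M K \<kappa> by (intro mult_mono) auto
            also have "\<dots> = \<kappa> * (M * c M)" using K by simp
            finally show ?thesis
              using False edge_cost_nonneg[OF g e] edge_cost_nonneg[OF ff e] b_nonneg
              by (simp add: w_def x_def z_def add_increasing)
          qed
        qed
        also have "\<dots> = (?L g + b * ?L f) / (1 + b) + N * \<kappa> * (M * c M)"
          by (simp add: social_cost_def x_def z_def N_def sum.distrib sum_distrib_left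
              flip: sum_divide_distrib)
        finally have "(1 + b) * ?L f \<le> (1 + b) * ((?L g + b * ?L f) / (1 + b) + N * \<kappa> * (M * c M))"
          using b_nonneg by (intro mult_left_mono) auto
        also have "\<dots> = ?L g + b * ?L f + (1 + b) * (N * \<kappa>) * (M * c M)"
          using b_nonneg by (simp add: distrib_left[of "1 + b" "_ / _"] mult.assoc)
        \<comment> \<open>The term \<open>b * ?L f\<close> produced by Young's inequality
          cancels.\<close>
        finally have "?L f \<le> ?L g + (1 + b) * (N * \<kappa>) * (M * c M)" by (simp add: algebra_simps)
        also have "(1 + b) * (N * \<kappa>) * (M * c M) \<le> \<epsilon> * \<delta> * (M * c M)"
          using N\<kappa> Mc by (intro mult_right_mono) auto
        also have "\<dots> \<le> \<epsilon> * ?L g" using lower g assms by (simp add: mult.assoc)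
        finally show ?thesis by (simp add: algebra_simps)
      qed
    qed
  qed
qed

text \<open>The lower bound makes \<open>Opt\<close> positive for small \<open>M\<close>, so the
  default value 1 of \<open>PoA\<close> is not taken. Continuity yields an equilibrium, so the
  choice in \<open>Eq\<close> is a genuine one.\<close>

lemma PoA_tendsto_1:
  assumes cont: "\<And>e. e \<in> E \<Longrightarrow> continuous_on {0..} (ce e)"
  shows "((\<lambda>M. PoA E P ce M) \<longlongrightarrow> 1) (at_right 0)"
proof (rule tendstoI)
  fix \<epsilon> :: real assume "0 < \<epsilon>"
  obtain \<delta> where \<delta>: "0 < \<delta>"
    "\<forall>\<^sub>F M in at_right 0. \<forall>g. feasible P M g \<longrightarrow> \<delta> * (M * c M) \<le> social_cost E P ce g"
    by (rule social_cost_lower_bound)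
  \<comment> \<open>Halving leaves room for the strict inequality in the definition of a
    limit.\<close>
  have "0 < \<epsilon> / 2" using \<open>0 < \<epsilon>\<close> by simp
  from wardrop_cost_le_all_flows[OF this] \<delta>(2) eventually_at_right_less[of 0]
  show "\<forall>\<^sub>F M in at_right 0. dist (PoA E P ce M) 1 < \<epsilon>"
  proof eventually_elim
    case (elim M)
    let ?L = "social_cost E P ce"
    define f where "f = (SOME f. wardrop_eq P ce M f)"
    have "\<exists>f. wardrop_eq P ce M f"
      using wardrop_eq_exists[of P M ce] finP p0 elim cont paths by (auto simp: subset_iff)
    then have f: "wardrop_eq P ce M f" unfolding f_def by (rule someI_ex)
    then have ff: "feasible P M f" by (simp add: wardrop_eq_def)
    have lower: "\<delta> * (M * c M) \<le> ?L g" if "feasible P M g" for g using elim that by blast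
    have pos: "0 < \<delta> * (M * c M)" using \<delta>(1) elim c_pos by simp
    have "\<delta> * (M * c M) \<le> Opt E P ce M"
      unfolding Opt_def using ff lower by (intro cINF_greatest) auto
    then have O0: "0 < Opt E P ce M" using pos by simp
    have "Opt E P ce M \<le> ?L f"
      unfolding Opt_def using ff lower by (intro cINF_lower bdd_belowI2) auto
    moreover have "?L f / (1 + \<epsilon> / 2) \<le> Opt E P ce M"
      unfolding Opt_def
    proof (rule cINF_greatest)
      show "{f. feasible P M f} \<noteq> {}" using ff by auto
      fix g assume "g \<in> {f. feasible P M f}"
      then have "?L f \<le> (1 + \<epsilon> / 2) * ?L g" using elim(1) f by blast
      then show "?L f / (1 + \<epsilon> / 2) \<le> ?L g" using \<open>0 < \<epsilon>\<close> by (simp add: pos_divide_le_eq mult.commute)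
    qed
    then have "?L f \<le> (1 + \<epsilon> / 2) * Opt E P ce M"
      using \<open>0 < \<epsilon>\<close> by (simp add: pos_divide_le_eq mult.commute)
    moreover have "PoA E P ce M = ?L f / Opt E P ce M"
      using O0 by (simp add: PoA_def Eq_def f_def)
    ultimately have "1 \<le> PoA E P ce M" "PoA E P ce M \<le> 1 + \<epsilon> / 2"
      using O0 by (auto simp: pos_le_divide_eq pos_divide_le_eq)
    then show ?case using \<open>0 < \<epsilon>\<close> by (simp add: dist_real_def)
  qed
qed

end

section \<open>From the benchmark and tightness to the abstract network\<close>

theorem theorem4p2:
  fixes E :: "'e set" and src tgt :: "'e \<Rightarrow> 'v" and orig dest :: 'v
    and P :: "'e list set" and ce :: "'e \<Rightarrow> real \<Rightarrow> real" and c :: "real \<Rightarrow> real"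
  assumes "finite E"
    and "finite P" and "P \<noteq> {}"
    and "\<forall>p\<in>P. is_path E src tgt orig dest p"
    and "\<forall>e\<in>E. continuous_on {0..} (ce e)"
    and "\<forall>e\<in>E. mono_on {0..} (ce e)"
    and "\<forall>e\<in>E. \<forall>x\<ge>0. ce e x \<ge> 0"
    and "benchmark_at_0 E ce c"
    and "0 < alpha P ce c" and "alpha P ce c < \<infinity>"
  shows "((\<lambda>M. PoA E P ce M) \<longlongrightarrow> 1) (at_right 0)"
proof -
  let ?\<alpha> = "alpha_e ce c"
  let ?max = "\<lambda>p. MAX e\<in>set p. ?\<alpha> e"
  have rv: "regularly_varying_at_0 c" using assms by (simp add: benchmark_at_0_def)
  then have c0: "0 < c x" if "0 < x" for x using that by (simp add: regularly_varying_at_0_def)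
  have path: "set p \<subseteq> E" "set p \<noteq> {}" if "p \<in> P" for p
    using bspec[OF assms(4) that] by (simp_all add: is_path_def)
  have lim: "((\<lambda>x. ereal (ce e x / c x)) \<longlongrightarrow> ?\<alpha> e) (at_right 0)" if "e \<in> E" for e
  proof -
    have "\<exists>l. ((\<lambda>x. ereal (ce e x / c x)) \<longlongrightarrow> l) (at_right 0)"
      using assms(8) that by (simp add: benchmark_at_0_def)
    then obtain l where l: "((\<lambda>x. ereal (ce e x / c x)) \<longlongrightarrow> l) (at_right 0)" ..
    moreover have "?\<alpha> e = l"
      unfolding alpha_e_def by (rule tendsto_Lim[OF _ l]) simp
    ultimately show ?thesis by simp
  qed
  have nonneg: "0 \<le> ?\<alpha> e" if "e \<in> E" for e
  proof (rule tendsto_lowerbound[OF lim[OF that]])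
    show "\<forall>\<^sub>F x in at_right 0. 0 \<le> ereal (ce e x / c x)"
      using eventually_at_right_less[of 0]
    proof eventually_elim
      case (elim x)
      then show ?case using assms(7) that c0[OF elim] by (simp add: less_imp_le)
    qed
  qed simp
  \<comment> \<open>An infinite limit is sent to 0 here, so \<open>a\<close> is meaningful only on
    \<open>A\<close>.\<close>
  define a where "a e = real_of_ereal (?\<alpha> e)" for e
  define A where "A = {e\<in>E. ?\<alpha> e < \<infinity>}"
  have a: "?\<alpha> e = ereal (a e)" if "e \<in> A" for e
    using that nonneg[of e] by (auto simp: a_def A_def ereal_real)
  have alim: "((\<lambda>x. ce e x / c x) \<longlongrightarrow> a e) (at_right 0)" if "e \<in> A" for e
    using lim[of e] a[OF that] that by (simp add: A_def)
  have "alpha P ce c \<in> ?max ` P"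
    unfolding alpha_def using assms(2,3) by (intro Min_in) auto
  then obtain p0 where p0: "p0 \<in> P" "alpha P ce c = ?max p0" by auto
  have "?\<alpha> e \<le> alpha P ce c" if "e \<in> set p0" for e
    unfolding p0(2) using that by simp
  then have "?\<alpha> e < \<infinity>" if "e \<in> set p0" for e
    using that assms(10) le_less_trans by blast
  then have p0A: "set p0 \<subseteq> A" using path[OF p0(1)] by (auto simp: A_def)
  have maxE: "\<exists>e\<in>set p. ?\<alpha> e = ?max p" if "p \<in> P" for p
  proof -
    have "?max p \<in> ?\<alpha> ` set p" using path[OF that] by (intro Max_in) auto
    then show ?thesis by auto
  qed
  \<comment> \<open>The cost of \<open>e0\<close> is monotone and comparable to \<open>c\<close>,
    with a limit ratio that is positive and finite; it supplies the index \<open>b\<close>.\<close>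
  obtain e0 where e0: "e0 \<in> set p0" "?\<alpha> e0 = alpha P ce c" using maxE[OF p0(1)] p0(2) by auto
  have e0A: "e0 \<in> A" "e0 \<in> E" using e0(1) p0A by (auto simp: A_def)
  have "0 < ereal (a e0)" using e0(2) assms(9) a[OF e0A(1)] by simp
  then have "0 < a e0" by simp
  from regularly_varying_power_limit[OF rv bspec[OF assms(6) e0A(2)] alim[OF e0A(1)] this]
  obtain b where b: "0 \<le> b"
    "\<And>y. 0 < y \<Longrightarrow> ((\<lambda>t. c (t * y) / c t) \<longlongrightarrow> y powr b) (at_right 0)" by blast
  interpret tight_network E A P ce c a b p0
  proof
    show "0 \<le> a e" if "e \<in> A" for e using nonneg[of e] a[OF that] that by (simp add: A_def)
    show "((\<lambda>M. ce e (M * y) / c M) \<longlongrightarrow> a e * y powr b) (at_right 0)" if "e \<in> A" "0 < y" for e y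
      using that by (intro tendsto_rescale_benchmark c0 alim b) auto
    show "filterlim (\<lambda>M. ce e (M * y) / c M) at_top (at_right 0)" if "e \<in> E - A" "0 < y" for e y
    proof (rule at_top_rescale_benchmark[OF c0 _ _ _ b(2)])
      have "?\<alpha> e = \<infinity>" using that by (auto simp: A_def)
      then show "filterlim (\<lambda>x. ce e x / c x) at_top (at_right 0)"
        using lim[of e] that by (simp add: tendsto_PInfty_eq_at_top)
    qed (use that in auto)
    show "\<exists>e\<in>set p. e \<in> A \<longrightarrow> 0 < a e" if p: "p \<in> P" for p
    proof -
      \<comment> \<open>The maximum along any path is at least the minimum over paths, which is
        positive.\<close>
      obtain e where e: "e \<in> set p" "?\<alpha> e = ?max p" using maxE[OF p] by auto
      have "alpha P ce c \<le> ?max p" unfolding alpha_def using p assms(2) by (intro Min_le) auto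
      then have "0 < ?\<alpha> e" using e assms(9) by simp
      then show ?thesis using e a[of e] by (intro bexI[of _ e]) auto
    qed
  qed (use assms(1,2,6,7) path(1) b(1) c0 p0(1) p0A in \<open>simp_all add: A_def\<close>)
  show ?thesis using assms(5) by (intro PoA_tendsto_1) auto
qed

end
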